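(* $\mathrm{Rubel}_0(1)\not\subset \mathrm{Rubel}_0(3)$; that is, there is a simply connected domain in $\mathbb{C}$ that belongs to $\mathrm{Rubel}(1)$ but not to $\mathrm{Rubel}(3)$. In particular, $\mathrm{Rubel}(1)\not\subset \mathrm{Rubel}(3)$.
   Context: A domain is a nonempty connected open subset of $\mathbb{C}$. For an integer $k\ge 1$, $\mathrm{Rubel}(k)$ is the set of domains $\Omega\subset\mathbb{C}$ such that for every unbounded analytic function $f:\Omega\to\mathbb{C}$ there is a sequence $\{z_n\}_{n\in\mathbb{N}}\subset\Omega$ along which $f,f',f'',\dots,f^{(k)}$ all tend to infinity, i.e. $|f^{(j)}(z_n)|\to\infty$ as $n\to\infty$ for each $0\le j\le k$. $\mathrm{Rubel}_0(k)$ is the set of simply connected domains belonging to $\mathrm{Rubel}(k)$. *)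

theory Defs
  imports "HOL-Complex_Analysis.Complex_Analysis"
begin

definition complex_domain :: "complex set \<Rightarrow> bool" where
  "complex_domain \<Omega> \<longleftrightarrow> \<Omega> \<noteq> {} \<and> open \<Omega> \<and> connected \<Omega>"

text \<open>
  Functions on \<open>\<Omega>\<close> are represented by total functions on the complex plane. Since \<open>\<Omega>\<close> is open,
  the iterated derivatives at points of \<open>\<Omega>\<close> do not depend on the values outside \<open>\<Omega>\<close>.
  The filter \<open>at_infinity\<close> expresses that the modulus tends to infinity.
  The notion is meant for \<open>k \<ge> 1\<close>.
\<close>
definition Rubel :: "nat \<Rightarrow> complex set set" where
  "Rubel k = {\<Omega>. complex_domain \<Omega> \<and>
     (\<forall>f :: complex \<Rightarrow> complex. f analytic_on \<Omega> \<and> \<not> bounded (f ` \<Omega>) \<longrightarrow>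
        (\<exists>z :: nat \<Rightarrow> complex. (\<forall>n. z n \<in> \<Omega>) \<and>
           (\<forall>j\<le>k. filterlim (\<lambda>n. (deriv ^^ j) f (z n)) at_infinity sequentially)))}"

definition Rubel0 :: "nat \<Rightarrow> complex set set" where
  "Rubel0 k = {\<Omega> \<in> Rubel k. simply_connected \<Omega>}"

end

theory Submission
  imports Defs
begin

text \<open>
  A bounded domain that is star-shaped about a point is in \<open>Rubel 1\<close>: on the final part of a
  segment where \<open>f\<close> exceeds the threshold, \<open>f'\<close> is bounded, and the segment has bounded length.

  The domain used here consists of a small disc and of thin sectors with vertex \<open>0\<close> around the
  rays of slope \<open>2\<^sup>-\<^sup>n\<close>. The unbounded function is a sum of terms that are negligible
  outside the \<open>n\<close>-th sector and before the point of abscissa about \<open>1\<close> on that sector, and nearly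
  linear with slope of order \<open>2\<^sup>n\<close> beyond this point. So its second derivative is bounded except
  near the kinks, where the function itself is bounded. The kink is produced by two branch points
  \<open>1/\<alpha>\<close> and \<open>1/\<beta>\<close> very close to each other on opposite sides of the sector: for
  \<open>A = csqrt (1 - \<alpha> z)\<close> and \<open>B = csqrt (1 - \<beta> z)\<close>, the difference \<open>A\<^sup>2 - B\<^sup>2 = (\<beta> - \<alpha>) z\<close> is tiny,
  hence so is \<open>(A - B)\<^sup>2\<close> wherever both roots lie in a common quadrant, whereas between the two
  branch cuts \<open>B\<close> is close to \<open>- A\<close>.
\<close>

section \<open>Criteria for membership and non-membership in \<open>Rubel k\<close>\<close>

lemma starlike_bounded_deriv_imp_bounded:
  fixes f :: "complex \<Rightarrow> complex"
  assumes S: "open S" "bounded S" "a \<in> S" "\<And>z. z \<in> S \<Longrightarrow> closed_segment a z \<subseteq> S"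
    and f: "f holomorphic_on S"
    and K: "\<And>z. z \<in> S \<Longrightarrow> norm (f z) < K \<or> norm (deriv f z) < K"
  shows "bounded (f ` S)"
proof -
  \<comment> \<open>Including \<open>norm (f a)\<close> puts the parameter 0 into the set
    \<open>T\<close> below, so \<open>T\<close> has a last element \<open>t0\<close>.\<close>
  define K' where "K' = max K (norm (f a))"
  obtain D where D: "\<And>z. z \<in> S \<Longrightarrow> norm z \<le> D" using S(2) bounded_iff by blast
  have K0: "K \<ge> 0" using K[OF S(3)] norm_ge_zero less_imp_le order_trans by metis
  have D0: "D \<ge> 0" using D[OF S(3)] norm_ge_zero order_trans by metis
  have "norm (f z) \<le> K' + K * (2 * D)" if z: "z \<in> S" for z
  proof (cases "norm (f z) \<le> K'")
    case True
    then show ?thesis using K0 D0 by (simp add: add_increasing2)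
  next
    case False
    define \<gamma> where "\<gamma> t = a + of_real t * (z - a)" for t :: real
    have \<gamma>S: "\<gamma> t \<in> S" if "t \<in> {0..1}" for t
    proof -
      have "\<gamma> t = (1 - t) *\<^sub>R a + t *\<^sub>R z"
        by (simp add: \<gamma>_def scaleR_conv_of_real algebra_simps)
      then show ?thesis using S(4)[OF z] that by (auto simp: closed_segment_def)
    qed
    have contf: "continuous_on {0..1} (\<lambda>t. f (\<gamma> t))"
      by (rule continuous_on_compose2[OF holomorphic_on_imp_continuous_on[OF f]])
         (auto simp: \<gamma>_def intro!: continuous_intros dest: \<gamma>S[unfolded \<gamma>_def])
    define T where "T = {0..1} \<inter> (\<lambda>t. norm (f (\<gamma> t))) -` {..K'}"
    have "closed T" unfolding T_def
      by (intro continuous_closed_preimage continuous_on_norm contf closed_atMost) auto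
    moreover have T01: "T \<subseteq> {0..1}" by (auto simp: T_def)
    ultimately have cT: "compact T"
      using compact_Int_closed[of "{0..1::real}" T] by (simp add: Int_absorb1)
    have "0 \<in> T" by (auto simp: T_def \<gamma>_def K'_def)
    then obtain t0 where t0: "t0 \<in> T" "\<And>t. t \<in> T \<Longrightarrow> t \<le> t0"
      using compact_attains_sup[OF cT] by blast
    have "1 \<notin> T" using False by (simp add: T_def \<gamma>_def)
    then have t01: "0 \<le> t0" "t0 < 1" using t0(1) T01 by (auto simp: less_le)
    have "norm (f (\<gamma> 1) - f (\<gamma> t0)) \<le> (K * (2 * D)) * 1 - (K * (2 * D)) * t0"
    proof (rule differentiable_bound_general[OF t01(2)])
      show "continuous_on {t0..1} (\<lambda>t. f (\<gamma> t))"
        by (rule continuous_on_subset[OF contf]) (use t01 in auto)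
      show "continuous_on {t0..1} ((*) (K * (2 * D)))" by (intro continuous_intros)
      fix t assume t: "t0 < t" "t < 1"
      then have tS: "\<gamma> t \<in> S" using \<gamma>S t01 by auto
      have "(f has_field_derivative deriv f (\<gamma> t)) (at (\<gamma> t))"
        using f S(1) tS by (rule holomorphic_derivI)
      moreover have "(\<gamma> has_vector_derivative (z - a)) (at t)"
        unfolding \<gamma>_def by (auto intro!: derivative_eq_intros)
      ultimately show "((\<lambda>t. f (\<gamma> t)) has_vector_derivative (z - a) * deriv f (\<gamma> t)) (at t)"
        using field_vector_diff_chain_at[of \<gamma> "z - a" t f] by (simp add: o_def)
      show "((*) (K * (2 * D)) has_vector_derivative K * (2 * D)) (at t)"
        by (auto intro!: derivative_eq_intros)
      \<comment> \<open>Past \<open>t0\<close> the modulus of \<open>f\<close> exceeds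
        \<open>K'\<close>, hence \<open>K\<close>, which leaves only the second alternative of the
        hypothesis \<open>K\<close>.\<close>
      have "t \<notin> T" using t0(2) t by force
      then have "norm (f (\<gamma> t)) > K'" using t t01 by (auto simp: T_def)
      then have "norm (deriv f (\<gamma> t)) < K" using K[OF tS] by (auto simp: K'_def)
      moreover have "norm (z - a) \<le> 2 * D"
        using norm_triangle_ineq4[of z a] D[OF z] D[OF S(3)] by linarith
      ultimately show "norm ((z - a) * deriv f (\<gamma> t)) \<le> K * (2 * D)"
        unfolding norm_mult using K0 D0
        by (subst mult.commute) (intro mult_mono, auto)
    qed
    also have "\<dots> \<le> K * (2 * D)" using K0 D0 t01 by simp
    finally have "norm (f z) - norm (f (\<gamma> t0)) \<le> K * (2 * D)"
      using norm_triangle_ineq2[of "f (\<gamma> 1)" "f (\<gamma> t0)"] by (simp add: \<gamma>_def)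
    then show ?thesis using t0(1) by (auto simp: T_def)
  qed
  then show ?thesis unfolding bounded_iff by blast
qed

text \<open>The contrapositive of the previous lemma with threshold \<open>n\<close>, for every
  \<open>n\<close>, yields points where \<open>f\<close> and its derivative both have modulus at
  least \<open>n\<close>.\<close>

lemma starlike_bounded_in_Rubel_1:
  assumes S: "open S" "bounded S" "a \<in> S" "\<And>z. z \<in> S \<Longrightarrow> closed_segment a z \<subseteq> S"
  shows "S \<in> Rubel 1"
proof -
  have "starlike S" using S(3,4) by (auto simp: starlike_def)
  then have dom: "complex_domain S"
    using S(1,3) starlike_imp_connected by (auto simp: complex_domain_def)
  have "\<exists>z :: nat \<Rightarrow> complex. (\<forall>n. z n \<in> S) \<and>
           (\<forall>j\<le>1. filterlim (\<lambda>n. (deriv ^^ j) f (z n)) at_infinity sequentially)"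
    if f: "f analytic_on S" "\<not> bounded (f ` S)" for f
  proof -
    have "f holomorphic_on S" using f(1) by (rule analytic_imp_holomorphic)
    then have "\<exists>z\<in>S. norm (f z) \<ge> real n \<and> norm (deriv f z) \<ge> real n" for n
      using starlike_bounded_deriv_imp_bounded[OF S, of f "real n"] f(2) by force
    then obtain z where z: "\<And>n. z n \<in> S" "\<And>n. norm (f (z n)) \<ge> real n"
      "\<And>n. norm (deriv f (z n)) \<ge> real n" by metis
    have lim: "filterlim g at_infinity sequentially" if "\<And>n. norm (g n) \<ge> real n"
      for g :: "nat \<Rightarrow> complex"
      unfolding filterlim_at_infinity_conv_norm_at_top
      by (rule filterlim_at_top_mono[OF filterlim_real_sequentially]) (use that in auto)
    have "(deriv ^^ j) f = f \<or> (deriv ^^ j) f = deriv f" if "j \<le> 1" for j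
      using that by (cases j) auto
    then have "\<forall>j\<le>1. filterlim (\<lambda>n. (deriv ^^ j) f (z n)) at_infinity sequentially"
      by (metis lim z(2,3))
    then show ?thesis using z(1) by blast
  qed
  then show ?thesis using dom by (auto simp: Rubel_def)
qed

lemma not_Rubel_if_bounded_cases:
  assumes "f analytic_on S" "\<not> bounded (f ` S)" "j \<le> k"
    and M: "\<And>z. z \<in> S \<Longrightarrow> norm (f z) \<le> M \<or> norm ((deriv ^^ j) f z) \<le> M"
  shows "S \<notin> Rubel k"
proof
  assume "S \<in> Rubel k"
  then obtain z :: "nat \<Rightarrow> complex" where z: "\<And>n. z n \<in> S"
    "\<And>i. i \<le> k \<Longrightarrow> filterlim (\<lambda>n. (deriv ^^ i) f (z n)) at_infinity sequentially"
    using assms(1,2) unfolding Rubel_def by blast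
  have ev: "\<forall>\<^sub>F n in sequentially. norm ((deriv ^^ i) f (z n)) > M" if "i \<le> k" for i
    using z(2)[OF that] by (simp add: filterlim_at_infinity_conv_norm_at_top filterlim_at_top_dense)
  have "\<forall>\<^sub>F n in sequentially. norm ((deriv ^^ 0) f (z n)) > M \<and> norm ((deriv ^^ j) f (z n)) > M"
    using ev[of 0] ev[OF assms(3)] by (auto intro: eventually_conj)
  then obtain n where "norm (f (z n)) > M" "norm ((deriv ^^ j) f (z n)) > M"
    by (auto simp: eventually_sequentially)
  then show False using M[OF z(1)[of n]] by linarith
qed

section \<open>Differences of square roots and the kink function\<close>

text \<open>For the roots \<open>A\<close>, \<open>B\<close> the hypothesis forces the real part of
  \<open>A * cnj B\<close> to be nonnegative, so \<open>norm (A - B) \<le> norm (A + B)\<close>; the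
  product of these two norms is \<open>norm (u - v)\<close>.\<close>

lemma norm_csqrt_diff_le:
  assumes "(Re u \<ge> 0 \<and> Re v \<ge> 0) \<or> Im u * Im v > 0"
  shows "(norm (csqrt u - csqrt v))\<^sup>2 \<le> norm (u - v)"
proof -
  obtain A B where AB: "A = csqrt u" "B = csqrt v" by blast
  have uv: "u = A\<^sup>2" "v = B\<^sup>2" by (auto simp: AB)
  have re: "Re A \<ge> 0" "Re B \<ge> 0" unfolding AB by (rule Re_csqrt)+
  have Re2: "Re (X\<^sup>2) = (Re X)\<^sup>2 - (Im X)\<^sup>2" and Im2: "Im (X\<^sup>2) = 2 * Re X * Im X" for X
    by (auto simp: power2_eq_square)
  have "Re A * Re B + Im A * Im B \<ge> 0"
    using assms
  proof (elim disjE conjE)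
    assume "Re u \<ge> 0" "Re v \<ge> 0"
    then have "\<bar>Im A\<bar> \<le> \<bar>Re A\<bar>" "\<bar>Im B\<bar> \<le> \<bar>Re B\<bar>"
      by (auto simp: uv Re2 abs_le_square_iff)
    then have "\<bar>Im A * Im B\<bar> \<le> Re A * Re B"
      unfolding abs_mult using re by (intro mult_mono) auto
    then show ?thesis by linarith
  next
    assume "Im u * Im v > 0"
    \<comment> \<open>This product is a quarter of \<open>Im u * Im v\<close>; as
      \<open>Re A * Re B\<close> is nonnegative, both factors are positive.\<close>
    then have "(Re A * Re B) * (Im A * Im B) > 0" by (simp add: uv Im2 algebra_simps)
    then show ?thesis using re
      by (smt (verit) mult_nonneg_nonneg zero_less_mult_iff)
  qed
  then have "(norm (A - B))\<^sup>2 \<le> (norm (A + B))\<^sup>2"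
    unfolding cmod_power2 by (simp add: power2_eq_square algebra_simps)
  then have "norm (A - B) \<le> norm (A + B)" by (simp add: abs_le_square_iff[symmetric])
  then have "norm (A - B) * norm (A - B) \<le> norm (A - B) * norm (A + B)"
    by (intro mult_left_mono) auto
  also have "\<dots> = norm (u - v)"
    unfolding uv norm_mult[symmetric] by (simp add: algebra_simps power2_eq_square)
  finally show ?thesis by (simp add: AB power2_eq_square)
qed

definition kink :: "real \<Rightarrow> complex \<Rightarrow> complex \<Rightarrow> complex \<Rightarrow> complex" where
  "kink N \<alpha> \<beta> z = N * (csqrt (1 - \<alpha> * z) - csqrt (1 - \<beta> * z))\<^sup>2"

definition kink' :: "real \<Rightarrow> complex \<Rightarrow> complex \<Rightarrow> complex \<Rightarrow> complex" where
  "kink' N \<alpha> \<beta> z = N * (csqrt (1 - \<alpha> * z) - csqrt (1 - \<beta> * z))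
     * (\<beta> * csqrt (1 - \<alpha> * z) - \<alpha> * csqrt (1 - \<beta> * z))
     / (csqrt (1 - \<alpha> * z) * csqrt (1 - \<beta> * z))"

text \<open>With \<open>A\<close>, \<open>B\<close> the two roots, \<open>kink\<close> equals
  \<open>N * (2 - (\<alpha> + \<beta>) * z - 2 * A * B)\<close>, and \<open>(A * B)\<^sup>2\<close>
  is a quadratic polynomial of discriminant \<open>(\<alpha> - \<beta>)\<^sup>2\<close>. Hence the
  second derivative has a constant numerator.\<close>

definition kink'' :: "real \<Rightarrow> complex \<Rightarrow> complex \<Rightarrow> complex \<Rightarrow> complex" where
  "kink'' N \<alpha> \<beta> z = N * (\<alpha> - \<beta>)\<^sup>2 / (2 * (csqrt (1 - \<alpha> * z) * csqrt (1 - \<beta> * z)) ^ 3)"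

lemma kink_derivs:
  assumes "1 - \<alpha> * z \<notin> \<real>\<^sub>\<le>\<^sub>0" "1 - \<beta> * z \<notin> \<real>\<^sub>\<le>\<^sub>0"
  shows "(kink N \<alpha> \<beta> has_field_derivative kink' N \<alpha> \<beta> z) (at z)"
    and "(kink' N \<alpha> \<beta> has_field_derivative kink'' N \<alpha> \<beta> z) (at z)"
proof -
  obtain A B where AB: "A = csqrt (1 - \<alpha> * z)" "B = csqrt (1 - \<beta> * z)" by blast
  have nz: "A \<noteq> 0" "B \<noteq> 0" using assms by (auto simp: AB)
  have A2: "A\<^sup>2 = 1 - \<alpha> * z" and B2: "B\<^sup>2 = 1 - \<beta> * z" by (auto simp: AB)
  have dA: "((\<lambda>z. csqrt (1 - \<alpha> * z)) has_field_derivative - \<alpha> / (2 * A)) (at z)"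
    and dB: "((\<lambda>z. csqrt (1 - \<beta> * z)) has_field_derivative - \<beta> / (2 * B)) (at z)"
    unfolding AB using assms by (auto intro!: derivative_eq_intros)
  have "(kink N \<alpha> \<beta> has_field_derivative
      N * (2 * (A - B) * (- \<alpha> / (2 * A) - - \<beta> / (2 * B)))) (at z)"
    unfolding kink_def[abs_def]
    by (rule derivative_eq_intros dA dB refl | simp add: AB)+
  also have "N * (2 * (A - B) * (- \<alpha> / (2 * A) - - \<beta> / (2 * B))) = kink' N \<alpha> \<beta> z"
    using nz unfolding kink'_def AB[symmetric] by (simp add: field_simps)
  finally show "(kink N \<alpha> \<beta> has_field_derivative kink' N \<alpha> \<beta> z) (at z)" .
  \<comment> \<open>The terms in \<open>z\<close> cancel; this identity turns the numerator from the
    quotient rule into a constant.\<close>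
  have "\<alpha> * B\<^sup>2 - \<beta> * A\<^sup>2 = \<alpha> - \<beta>" by (simp add: A2 B2 algebra_simps)
  then have key: "(\<alpha> - \<beta>)\<^sup>2 = (\<alpha> * B\<^sup>2 - \<beta> * A\<^sup>2)\<^sup>2" by simp
  have "(kink' N \<alpha> \<beta> has_field_derivative
      (N * (((- \<alpha> / (2 * A) - - \<beta> / (2 * B)) * (\<beta> * A - \<alpha> * B) +
       (\<beta> * (- \<alpha> / (2 * A)) - \<alpha> * (- \<beta> / (2 * B))) * (A - B)) * (A * B)
       - (A - B) * (\<beta> * A - \<alpha> * B) * ((- \<alpha> / (2 * A)) * B + (- \<beta> / (2 * B)) * A))
       / (A * B)\<^sup>2)) (at z)"
    unfolding kink'_def[abs_def]
    by (rule DERIV_cong[OF DERIV_divide[OF DERIV_mult[OF DERIV_cmult[OF DERIV_diff[OF dA dB]]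
            DERIV_diff[OF DERIV_cmult[OF dA] DERIV_cmult[OF dB]]] DERIV_mult[OF dA dB]]])
       (use nz in \<open>simp_all add: AB[symmetric] power2_eq_square algebra_simps\<close>)
  also have "(N * (((- \<alpha> / (2 * A) - - \<beta> / (2 * B)) * (\<beta> * A - \<alpha> * B) +
       (\<beta> * (- \<alpha> / (2 * A)) - \<alpha> * (- \<beta> / (2 * B))) * (A - B)) * (A * B)
       - (A - B) * (\<beta> * A - \<alpha> * B) * ((- \<alpha> / (2 * A)) * B + (- \<beta> / (2 * B)) * A))
       / (A * B)\<^sup>2) = kink'' N \<alpha> \<beta> z"
    using nz unfolding kink''_def AB[symmetric] key
    by (simp add: field_simps power2_eq_square power3_eq_cube)
  finally show "(kink' N \<alpha> \<beta> has_field_derivative kink'' N \<alpha> \<beta> z) (at z)" .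
qed

section \<open>Parameters and estimates for the individual terms\<close>

definition slope :: "nat \<Rightarrow> real" where "slope n = (1/2) ^ n"
text \<open>The cube makes the bound on \<open>kink_seq'\<close>, of order
  \<open>width n / slope n ^ 2\<close>, comparable to \<open>slope n\<close>; the factor 256 makes
  the constant in the bound on \<open>kink_seq''\<close> equal to 1.\<close>

definition width :: "nat \<Rightarrow> real" where "width n = slope n ^ 3 / 256"
text \<open>The branch point \<open>1 / upper n\<close> lies on the ray from 0 of slope
  \<open>slope n + width n\<close>, an edge of the \<open>n\<close>-th sector, and the cut continues
  along this ray to infinity. Likewise \<open>lower n\<close> belongs to the other edge.\<close>

definition upper :: "nat \<Rightarrow> complex" where "upper n = Complex 1 (- (slope n + width n))"
definition lower :: "nat \<Rightarrow> complex" where "lower n = Complex 1 (- (slope n - width n))"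

lemma slope_bounds: "0 < slope n" "slope n \<le> 1"
  by (auto simp: slope_def power_le_one)

lemma slope_sums: "slope sums 2"
  using geometric_sums[of "1/2 :: real"] by (simp add: slope_def[abs_def])

lemma width_bounds: "0 < width n" "width n \<le> slope n / 256"
proof -
  have "slope n ^ 3 \<le> slope n ^ 1" using slope_bounds[of n] by (intro power_decreasing) auto
  then show "width n \<le> slope n / 256" by (simp add: width_def)
qed (use slope_bounds[of n] in \<open>simp add: width_def\<close>)

lemma
  shows Re_upper: "Re (1 - upper n * z) = 1 - Re z - (slope n + width n) * Im z"
    and Im_upper: "Im (1 - upper n * z) = (slope n + width n) * Re z - Im z"
    and Re_lower: "Re (1 - lower n * z) = 1 - Re z - (slope n - width n) * Im z"
    and Im_lower: "Im (1 - lower n * z) = (slope n - width n) * Re z - Im z"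
  by (auto simp: upper_def lower_def algebra_simps)

lemma norm_upper_lower: "norm (upper n - lower n) = 2 * width n"
proof -
  have "upper n - lower n = of_real (2 * width n) * (- \<i>)"
    by (auto simp: complex_eq_iff upper_def lower_def)
  then show ?thesis
    using width_bounds(1)[of n] by (simp add: norm_mult)
qed

lemma norm_upper_diff: "norm ((1 - upper n * z) - (1 - lower n * z)) = 2 * width n * norm z"
proof -
  have "(1 - upper n * z) - (1 - lower n * z) = - ((upper n - lower n) * z)" by (simp add: algebra_simps)
  then show ?thesis by (simp only: norm_minus_cancel norm_mult norm_upper_lower)
qed

abbreviation "kink_seq n \<equiv> kink (1 / slope n) (upper n) (lower n)"
abbreviation "kink_seq' n \<equiv> kink' (1 / slope n) (upper n) (lower n)"
abbreviation "kink_seq'' n \<equiv> kink'' (1 / slope n) (upper n) (lower n)"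

text \<open>A strict form of the hypothesis of \<open>norm_csqrt_diff_le\<close>; strictness also
  keeps both arguments off the cut of \<open>csqrt\<close>.\<close>

definition same_side :: "complex \<Rightarrow> complex \<Rightarrow> bool" where
  "same_side u v \<longleftrightarrow> (Re u > 0 \<and> Re v > 0) \<or> Im u * Im v > 0"

lemma norm_kink_seq_le:
  assumes "norm z \<le> 3" "same_side (1 - upper n * z) (1 - lower n * z)"
  shows "norm (kink_seq n z) \<le> slope n"
proof -
  have "(norm (csqrt (1 - upper n * z) - csqrt (1 - lower n * z)))\<^sup>2 \<le> 2 * width n * norm z"
    unfolding norm_upper_diff[symmetric]
    by (rule norm_csqrt_diff_le) (use assms(2) in \<open>auto simp: same_side_def\<close>)
  also have "\<dots> \<le> 2 * width n * 3"
    using assms(1) width_bounds(1)[of n] by (intro mult_left_mono) auto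
  also have "\<dots> \<le> slope n ^ 3" using slope_bounds[of n] by (simp add: width_def)
  also have "\<dots> \<le> slope n ^ 2" using slope_bounds[of n] by (intro power_decreasing) auto
  finally have "norm (kink_seq n z) \<le> slope n ^ 2 / slope n"
    using slope_bounds(1)[of n]
    by (simp add: kink_def norm_mult norm_power norm_divide divide_right_mono)
  then show ?thesis by (simp add: power2_eq_square)
qed

text \<open>The two arguments differ by at most \<open>6 * width n\<close>, which is below
  \<open>slope n / 32\<close>.\<close>

lemma norm_lower_ge:
  assumes "norm z \<le> 3" "slope n / 16 \<le> norm (1 - upper n * z)"
  shows "slope n / 32 \<le> norm (1 - lower n * z)"
proof -
  have "norm (1 - upper n * z) - norm (1 - lower n * z) \<le> 2 * width n * norm z"
    unfolding norm_upper_diff[symmetric] by (rule norm_triangle_ineq2)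
  also have "\<dots> \<le> 2 * width n * 3"
    using assms(1) width_bounds(1)[of n] by (intro mult_left_mono) auto
  finally show ?thesis using assms(2) width_bounds(2)[of n] slope_bounds[of n] by linarith
qed

lemma norm_csqrt_mult_ge:
  assumes "norm z \<le> 3" "slope n / 16 \<le> norm (1 - upper n * z)"
  shows "slope n / 32 \<le> norm (csqrt (1 - upper n * z) * csqrt (1 - lower n * z))"
proof (rule power2_le_imp_le)
  have "(slope n / 32)\<^sup>2 \<le> norm (1 - upper n * z) * norm (1 - lower n * z)"
    unfolding power2_eq_square
    using assms(2) norm_lower_ge[OF assms] slope_bounds(1)[of n] by (intro mult_mono) auto
  then show "(slope n / 32)\<^sup>2 \<le> (norm (csqrt (1 - upper n * z) * csqrt (1 - lower n * z)))\<^sup>2"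
    by (simp add: norm_mult power_mult_distrib)
qed simp

text \<open>The roots enter \<open>kink''\<close> only through their product, whatever their signs,
  so the bound also holds inside the \<open>n\<close>-th sector, away from the branch
  points.\<close>

lemma norm_kink_seq''_le:
  assumes "norm z \<le> 3" "slope n / 16 \<le> norm (1 - upper n * z)"
  shows "norm (kink_seq'' n z) \<le> slope n"
proof -
  define P where "P = norm (csqrt (1 - upper n * z) * csqrt (1 - lower n * z))"
  have s: "0 < slope n" by (rule slope_bounds)
  have P: "slope n / 32 \<le> P" unfolding P_def by (rule norm_csqrt_mult_ge[OF assms])
  have "norm (kink_seq'' n z) = (1 / slope n) * (2 * width n)\<^sup>2 / (2 * P ^ 3)"
    using s norm_upper_lower[of n]
    by (simp add: kink''_def norm_mult norm_divide norm_power P_def)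
  also have "\<dots> \<le> (1 / slope n) * (2 * width n)\<^sup>2 / (2 * (slope n / 32) ^ 3)"
    using s P width_bounds(1)[of n]
    by (intro divide_left_mono mult_left_mono power_mono mult_pos_pos zero_less_power mult_nonneg_nonneg) auto
  \<comment> \<open>The constants cancel because \<open>2 * 32 ^ 3 = 256 ^ 2\<close>.\<close>
  also have "\<dots> = slope n ^ 2"
    using s by (simp add: width_def field_simps power2_eq_square power3_eq_cube)
  also have "\<dots> \<le> slope n" using power_decreasing[of 1 2 "slope n"] slope_bounds[of n] by simp
  finally show ?thesis .
qed

text \<open>The factor \<open>lower n * A - upper n * B\<close> is itself
  \<open>lower n * (A - B)\<close> up to order \<open>width n\<close>, so the numerator is
  controlled by \<open>(norm (A - B))\<^sup>2\<close> and \<open>width n\<close>. The bound serves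
  to differentiate the series a second time.\<close>

lemma norm_kink_seq'_le:
  assumes z: "norm z \<le> 3" and ss: "same_side (1 - upper n * z) (1 - lower n * z)"
    and far: "slope n / 16 \<le> norm (1 - upper n * z)"
  shows "norm (kink_seq' n z) \<le> 4 * slope n"
proof -
  obtain A B where AB: "A = csqrt (1 - upper n * z)" "B = csqrt (1 - lower n * z)" by blast
  have s: "0 < slope n" "slope n \<le> 1" and w: "0 < width n" "width n \<le> slope n / 256"
    using slope_bounds width_bounds by auto
  have "(norm (A - B))\<^sup>2 \<le> 2 * width n * norm z"
    unfolding norm_upper_diff[symmetric] AB
    by (rule norm_csqrt_diff_le) (use ss in \<open>auto simp: same_side_def\<close>)
  also have "\<dots> \<le> 2 * width n * 3" using z w by (intro mult_left_mono) auto
  finally have d: "(norm (A - B))\<^sup>2 \<le> 6 * width n" by simp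
  then have "(norm (A - B))\<^sup>2 \<le> 1\<^sup>2" using s w by simp
  then have d1: "norm (A - B) \<le> 1" using power2_le_imp_le zero_le_one by blast
  have lower3: "norm (lower n) \<le> 3"
    using cmod_le[of "lower n"] s w by (simp add: lower_def)
  have "norm (1 - lower n * z) \<le> 1 + 3 * 3"
    using norm_triangle_ineq4[of 1 "lower n * z"] mult_mono[OF lower3 z]
    by (simp add: norm_mult)
  then have "(norm B)\<^sup>2 \<le> 4\<^sup>2" by (simp add: AB)
  then have B4: "norm B \<le> 4" by (rule power2_le_imp_le) simp
  have "lower n * A - upper n * B = lower n * (A - B) - (upper n - lower n) * B" by (simp add: algebra_simps)
  then have "norm (lower n * A - upper n * B) \<le> norm (lower n) * norm (A - B) + 2 * width n * norm B"
    by (metis norm_triangle_ineq4 norm_mult norm_upper_lower)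
  also have "\<dots> \<le> 3 * norm (A - B) + 2 * width n * 4"
    using lower3 B4 w by (intro add_mono mult_mono) auto
  finally have "norm (A - B) * norm (lower n * A - upper n * B)
      \<le> norm (A - B) * (3 * norm (A - B) + 2 * width n * 4)"
    by (intro mult_left_mono) auto
  also have "\<dots> = 3 * (norm (A - B))\<^sup>2 + 8 * width n * norm (A - B)"
    by (simp add: power2_eq_square algebra_simps)
  also have "\<dots> \<le> 3 * (6 * width n) + 8 * width n * 1"
    using d d1 w by (intro add_mono mult_left_mono) auto
  finally have num: "norm (A - B) * norm (lower n * A - upper n * B) \<le> 26 * width n" by simp
  have P: "slope n / 32 \<le> norm (A * B)" unfolding AB by (rule norm_csqrt_mult_ge[OF z far])
  have "norm (kink_seq' n z) = (1 / slope n) * (norm (A - B) * norm (lower n * A - upper n * B)) / norm (A * B)"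
    using s by (simp add: kink'_def norm_mult norm_divide AB)
  also have "\<dots> \<le> (1 / slope n) * (26 * width n) / (slope n / 32)"
    using s w P num by (intro frac_le mult_left_mono mult_nonneg_nonneg) auto
  also have "\<dots> = 26 * 32 / 256 * slope n"
    using s by (simp add: width_def field_simps power3_eq_cube)
  also have "\<dots> \<le> 4 * slope n" using s by simp
  finally show ?thesis .
qed

text \<open>Near the branch points both roots are at most of order \<open>sqrt (slope n)\<close>, so
  the factor \<open>1 / slope n\<close> is absorbed without any cancellation between them.\<close>

lemma norm_kink_seq_near_le:
  assumes z: "norm z \<le> 3" and near: "norm (1 - upper n * z) \<le> slope n / 16"
  shows "norm (kink_seq n z) \<le> 1"
proof -
  obtain A B where AB: "A = csqrt (1 - upper n * z)" "B = csqrt (1 - lower n * z)" by blast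
  have s: "0 < slope n" "slope n \<le> 1" and w: "0 < width n" "width n \<le> slope n / 256"
    using slope_bounds width_bounds by auto
  have "norm (1 - lower n * z) - norm (1 - upper n * z) \<le> 2 * width n * norm z"
    unfolding norm_upper_diff[symmetric] by (subst norm_minus_commute) (rule norm_triangle_ineq2)
  also have "\<dots> \<le> 2 * width n * 3" using z w by (intro mult_left_mono) auto
  finally have "(norm B)\<^sup>2 \<le> slope n / 8" "(norm A)\<^sup>2 \<le> slope n / 16" using near s w by (auto simp: AB)
  moreover have "(norm (A - B))\<^sup>2 \<le> (norm A + norm B)\<^sup>2"
    by (intro power_mono norm_triangle_ineq4) auto
  moreover have "(norm A + norm B)\<^sup>2 \<le> 2 * (norm A)\<^sup>2 + 2 * (norm B)\<^sup>2"
    using sum_squares_bound[of "norm A" "norm B"] by (simp add: power2_sum)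
  ultimately have "(norm (A - B))\<^sup>2 \<le> slope n" using s by linarith
  then show ?thesis using s by (simp add: kink_def norm_mult norm_power norm_divide flip: AB)
qed

section \<open>The domain, and where each term is negligible\<close>

definition sector :: "nat \<Rightarrow> complex set" where
  "sector n = {z. 0 < Re z \<and> Re z < 5/4 \<and> \<bar>Im z - slope n * Re z\<bar> < width n * Re z}"

text \<open>The disc is repeated in every member of the union, so each point comes with an index
  \<open>m\<close> that is the only possible exception to \<open>regular\<close>.\<close>

definition star_dom :: "complex set" where
  "star_dom = (\<Union>m. ball 0 (1/4) \<union> sector m)"

lemma norm_le_3:
  assumes "z \<in> ball 0 (1/4) \<union> sector m"
  shows "norm z \<le> 3"
  using assms
proof
  assume z: "z \<in> sector m"
  then have "\<bar>Im z\<bar> < (slope m + width m) * Re z"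
    using slope_bounds[of m] by (simp add: sector_def algebra_simps abs_less_iff) (smt (verit) mult_nonneg_nonneg)
  also have "\<dots> \<le> (257/256) * (5/4)"
    using z slope_bounds[of m] width_bounds[of m] by (intro mult_mono) (auto simp: sector_def)
  finally show ?thesis using cmod_le[of z] z by (auto simp: sector_def)
qed auto

lemma norm_le_3_star_dom: "z \<in> star_dom \<Longrightarrow> norm z \<le> 3"
  using norm_le_3 by (auto simp: star_dom_def)

lemma open_base: "open (ball 0 (1/4) \<union> sector m)"
  unfolding sector_def
  by (intro open_Un open_ball open_Collect_conj open_Collect_less continuous_intros)

lemma open_star_dom: "open star_dom"
  unfolding star_dom_def by (intro open_UN open_base ballI)

lemma slope_separated:
  assumes "m \<noteq> n" shows "slope m \<le> slope n / 2 \<or> slope m \<ge> 2 * slope n"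
proof -
  have *: "slope q \<le> slope p / 2" if "p < q" for p q :: nat
    using power_decreasing[of "Suc p" q "1/2 :: real"] that by (simp add: slope_def)
  from assms consider "m < n" | "n < m" by linarith
  then show ?thesis using *[of m n] *[of n m] by cases auto
qed

definition regular :: "nat \<Rightarrow> complex \<Rightarrow> bool" where
  "regular n z \<longleftrightarrow> same_side (1 - upper n * z) (1 - lower n * z) \<and> slope n / 16 \<le> norm (1 - upper n * z)"

lemma regular_ball:
  assumes "z \<in> ball 0 (1/4)"
  shows "regular n z"
proof -
  have z: "\<bar>Re z\<bar> \<le> 1/4" "\<bar>Im z\<bar> \<le> 1/4"
    using assms abs_Re_le_cmod[of z] abs_Im_le_cmod[of z] by auto
  have s: "0 < slope n" "slope n \<le> 1" and w: "0 < width n" "width n \<le> slope n / 256"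
    using slope_bounds width_bounds by auto
  have "\<bar>(slope n + width n) * Im z\<bar> \<le> (257/256) * (1/4)" "\<bar>(slope n - width n) * Im z\<bar> \<le> 1 * (1/4)"
    unfolding abs_mult using s w z by (intro mult_mono; simp)+
  then have "Re (1 - upper n * z) \<ge> 1/4" "Re (1 - lower n * z) \<ge> 1/4"
    using z unfolding Re_upper Re_lower by (auto simp: abs_le_iff)
  then show ?thesis
    using abs_Re_le_cmod[of "1 - upper n * z"] s by (auto simp: regular_def same_side_def)
qed

text \<open>Slopes of different sectors differ by a factor of at least 2, far more than their widths
  allow for, so \<open>z\<close> lies on one side of both edges of the \<open>n\<close>-th
  sector.\<close>

lemma regular_sector:
  assumes z: "z \<in> sector m" and mn: "m \<noteq> n"
  shows "regular n z"
proof -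
  define x where "x = Re z"
  have x: "0 < x" using z by (simp add: sector_def x_def)
  have s: "0 < slope n" "slope n \<le> 1" "0 < slope m" "slope m \<le> 1"
    and w: "0 < width n" "width n \<le> slope n / 256" "0 < width m" "width m \<le> slope m / 256"
    using slope_bounds width_bounds by auto
  define \<sigma> where "\<sigma> = Im z / x"
  have y: "Im z = \<sigma> * x" using x by (simp add: \<sigma>_def)
  have "\<bar>\<sigma> - slope m\<bar> * x < width m * x"
    using z x by (simp add: sector_def y x_def[symmetric] abs_mult flip: left_diff_distrib)
  then have \<sigma>: "\<bar>\<sigma> - slope m\<bar> < width m" using x by simp
  have Im: "Im (1 - upper n * z) = (slope n + width n - \<sigma>) * x" "Im (1 - lower n * z) = (slope n - width n - \<sigma>) * x"
    unfolding Im_upper Im_lower y x_def[symmetric] by (auto simp: algebra_simps)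
  consider "slope m \<le> slope n / 2" | "slope m \<ge> 2 * slope n" using slope_separated[OF mn] by blast
  then have cs: "(slope n - width n - \<sigma> > slope n / 4 \<and> slope n + width n - \<sigma> > slope n / 4) \<or>
      (slope n - width n - \<sigma> < - (slope n / 4) \<and> slope n + width n - \<sigma> < - (slope n / 4))"
  proof cases
    case 1
    then have "slope n - width n - \<sigma> > slope n / 4" using \<sigma> s w by linarith
    then show ?thesis using w by linarith
  next
    case 2
    then have "slope n + width n - \<sigma> < - (slope n / 4)" using \<sigma> s w by linarith
    then show ?thesis using w by linarith
  qed
  have "(slope n + width n - \<sigma>) * (slope n - width n - \<sigma>) > 0"
    by (rule disjE[OF cs]) (use s in \<open>auto intro: mult_pos_pos mult_neg_neg simp del: diff_less_0_iff_less\<close>)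
  then have "Im (1 - upper n * z) * Im (1 - lower n * z) > 0"
    unfolding Im using x by (simp add: zero_less_mult_iff mult_less_0_iff)
  \<comment> \<open>Close to 0 the real part is large; farther out the imaginary part is at least
    \<open>slope n / 4 * (1/4)\<close>, which is the origin of the constant 16.\<close>
  moreover have "slope n / 16 \<le> norm (1 - upper n * z)"
  proof (cases "x \<le> 1/4")
    case True
    have "(slope n + width n) * (\<sigma> * x) \<le> (257/256) * ((257/256) * (1/4))"
      using True s w \<sigma> x by (intro mult_mono) auto
    then have "Re (1 - upper n * z) \<ge> 1/4" unfolding Re_upper y x_def[symmetric] using True by simp
    then show ?thesis using abs_Re_le_cmod[of "1 - upper n * z"] s by linarith
  next
    case False
    then have "slope n / 4 * (1/4) \<le> \<bar>slope n + width n - \<sigma>\<bar> * x"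
      using cs s by (intro mult_mono) auto
    also have "\<dots> = \<bar>Im (1 - upper n * z)\<bar>" unfolding Im abs_mult using x by simp
    also have "\<dots> \<le> norm (1 - upper n * z)" by (rule abs_Im_le_cmod)
    finally show ?thesis by simp
  qed
  ultimately show ?thesis by (auto simp: regular_def same_side_def)
qed

lemma regular_base: "z \<in> ball 0 (1/4) \<union> sector m \<Longrightarrow> m \<noteq> n \<Longrightarrow> regular n z"
  using regular_ball regular_sector by blast

lemma same_side_nonpos: "same_side u v \<Longrightarrow> u \<notin> \<real>\<^sub>\<le>\<^sub>0 \<and> v \<notin> \<real>\<^sub>\<le>\<^sub>0"
  by (auto simp: same_side_def complex_nonpos_Reals_iff)

lemma sector_Im:
  assumes "z \<in> sector n"
  shows "Im (1 - upper n * z) > 0" "Im (1 - lower n * z) < 0"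
  unfolding Im_upper Im_lower using assms by (auto simp: sector_def algebra_simps abs_less_iff)

text \<open>A point that is not regular for \<open>n\<close> lies in the \<open>n\<close>-th sector,
  where both imaginary parts are nonzero.\<close>

lemma star_dom_nonpos:
  assumes "z \<in> star_dom"
  shows "1 - upper n * z \<notin> \<real>\<^sub>\<le>\<^sub>0" "1 - lower n * z \<notin> \<real>\<^sub>\<le>\<^sub>0"
proof -
  have "1 - upper n * z \<notin> \<real>\<^sub>\<le>\<^sub>0 \<and> 1 - lower n * z \<notin> \<real>\<^sub>\<le>\<^sub>0"
  proof (cases "regular n z")
    case True
    then show ?thesis using same_side_nonpos by (auto simp: regular_def)
  next
    case False
    obtain m where m: "z \<in> ball 0 (1/4) \<union> sector m" using assms by (auto simp: star_dom_def)
    then have "z \<in> sector n" using False regular_ball[of z n] regular_base[OF m, of n] by blast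
    then show ?thesis
      using sector_Im[of z n] by (auto simp: complex_nonpos_Reals_iff)
  qed
  then show "1 - upper n * z \<notin> \<real>\<^sub>\<le>\<^sub>0" "1 - lower n * z \<notin> \<real>\<^sub>\<le>\<^sub>0" by auto
qed

section \<open>The unbounded function as a series of kinks\<close>

text \<open>A neighbourhood of \<open>z\<close> lies in the disc and a single sector
  \<open>m\<close>, so all terms with \<open>n > m\<close> are regular there. The conclusion has the
  form required for termwise differentiation.\<close>

lemma locally_dominated:
  fixes F :: "nat \<Rightarrow> complex \<Rightarrow> complex"
  assumes z: "z \<in> star_dom"
    and F: "\<And>n z. norm z \<le> 3 \<Longrightarrow> regular n z \<Longrightarrow> norm (F n z) \<le> 4 * slope n"
  shows "\<exists>d h. 0 < d \<and> summable h \<and> range h \<subseteq> \<real>\<^sub>\<ge>\<^sub>0 \<and>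
    (\<forall>\<^sub>F n in sequentially. \<forall>y\<in>ball z d \<inter> star_dom. cmod (F n y) \<le> cmod (h n))"
proof -
  obtain m where m: "z \<in> ball 0 (1/4) \<union> sector m" using z by (auto simp: star_dom_def)
  obtain d where d: "d > 0" "ball z d \<subseteq> ball 0 (1/4) \<union> sector m"
    using open_base m open_contains_ball by metis
  define h where "h n = complex_of_real (4 * slope n)" for n
  have "summable h"
    unfolding h_def using slope_sums by (intro summable_of_real summable_mult sums_summable)
  moreover have "range h \<subseteq> \<real>\<^sub>\<ge>\<^sub>0" using slope_bounds(1) by (auto simp: h_def less_imp_le)
  moreover have "cmod (F n y) \<le> cmod (h n)" if "n > m" "y \<in> ball z d" for n y
  proof -
    have "y \<in> ball 0 (1/4) \<union> sector m" using d that by auto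
    then have "norm (F n y) \<le> 4 * slope n"
      using that by (intro F norm_le_3 regular_base) auto
    then show ?thesis using slope_bounds(1)[of n] by (simp add: h_def norm_mult)
  qed
  then have "\<forall>\<^sub>F n in sequentially. \<forall>y\<in>ball z d \<inter> star_dom. cmod (F n y) \<le> cmod (h n)"
    by (auto intro: eventually_mono[OF eventually_gt_at_top[of m]])
  ultimately show ?thesis using d(1) by blast
qed

lemma series_minus_term:
  fixes F :: "nat \<Rightarrow> complex"
  assumes "F sums l" "\<And>n. n \<noteq> m \<Longrightarrow> norm (F n) \<le> slope n"
  shows "norm (l - F m) \<le> 2"
proof -
  have s: "(\<lambda>n. F n - (if n = m then F n else 0)) sums (l - F m)"
    by (intro sums_diff assms(1) sums_single)
  have "norm (suminf (\<lambda>n. F n - (if n = m then F n else 0))) \<le> suminf slope"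
    using assms(2) slope_bounds(1) slope_sums
    by (intro norm_suminf_le) (auto simp: sums_iff less_imp_le)
  then show ?thesis using s slope_sums by (simp add: sums_iff)
qed

text \<open>At a point with index \<open>m\<close>, the terms other than the \<open>m\<close>-th
  contribute at most 2, the sum of all slopes, to \<open>f\<close> and to its second derivative. The
  \<open>m\<close>-th term adds at most 1 to one of the two.\<close>

lemma exists_unbounded:
  obtains f where "f analytic_on star_dom" "\<not> bounded (f ` star_dom)"
    "\<And>z. z \<in> star_dom \<Longrightarrow> norm (f z) \<le> 3 \<or> norm ((deriv ^^ 2) f z) \<le> 3"
proof -
  have dom0: "norm (kink_seq n z) \<le> slope n" if "norm z \<le> 3" "regular n z" for n z
    using that(2) unfolding regular_def by (intro norm_kink_seq_le that(1)) simp
  have dom1: "norm (kink_seq' n z) \<le> 4 * slope n" if "norm z \<le> 3" "regular n z" for n z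
    using that(2) unfolding regular_def by (intro norm_kink_seq'_le that(1)) simp_all
  have dom2: "norm (kink_seq'' n z) \<le> slope n" if "norm z \<le> 3" "regular n z" for n z
    using that(2) unfolding regular_def by (intro norm_kink_seq''_le that(1)) simp
  have dom0': "norm (kink_seq n z) \<le> 4 * slope n" if "norm z \<le> 3" "regular n z" for n z
    using dom0[OF that] slope_bounds(1)[of n] by linarith
  have "\<exists>f f'. \<forall>z\<in>star_dom. (\<lambda>n. kink_seq n z) sums f z \<and> (\<lambda>n. kink_seq' n z) sums f' z \<and>
      (f has_field_derivative f' z) (at z)"
    by (rule series_and_derivative_comparison_complex[OF open_star_dom])
       (use kink_derivs(1) star_dom_nonpos in blast, rule locally_dominated[OF _ dom0'])
  then obtain f f' where f: "\<And>z. z \<in> star_dom \<Longrightarrow> (\<lambda>n. kink_seq n z) sums f z"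
      "\<And>z. z \<in> star_dom \<Longrightarrow> (\<lambda>n. kink_seq' n z) sums f' z"
      "\<And>z. z \<in> star_dom \<Longrightarrow> (f has_field_derivative f' z) (at z)"
    by blast
  \<comment> \<open>A second termwise differentiation; its sum \<open>g\<close> agrees with
    \<open>f'\<close> by uniqueness of limits.\<close>
  have "\<exists>f f'. \<forall>z\<in>star_dom. (\<lambda>n. kink_seq' n z) sums f z \<and> (\<lambda>n. kink_seq'' n z) sums f' z \<and>
      (f has_field_derivative f' z) (at z)"
    by (rule series_and_derivative_comparison_complex[OF open_star_dom])
       (use kink_derivs(2) star_dom_nonpos in blast, rule locally_dominated[OF _ dom1])
  then obtain g g' where g: "\<And>z. z \<in> star_dom \<Longrightarrow> (\<lambda>n. kink_seq' n z) sums g z"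
      "\<And>z. z \<in> star_dom \<Longrightarrow> (\<lambda>n. kink_seq'' n z) sums g' z"
      "\<And>z. z \<in> star_dom \<Longrightarrow> (g has_field_derivative g' z) (at z)"
    by blast
  have f'g: "deriv f z = g z" if "z \<in> star_dom" for z
    using DERIV_imp_deriv[OF f(3)[OF that]] sums_unique2[OF f(2)[OF that] g(1)[OF that]] by simp
  have d2: "(deriv ^^ 2) f z = g' z" if z: "z \<in> star_dom" for z
  proof -
    have "\<forall>\<^sub>F w in nhds z. deriv f w = g w"
      using eventually_nhds_in_open[OF open_star_dom z] by eventually_elim (rule f'g)
    then have "deriv (deriv f) z = deriv g z" by (rule deriv_cong_ev) simp
    also have "\<dots> = g' z" by (rule DERIV_imp_deriv[OF g(3)[OF z]])
    finally show ?thesis by (simp add: numeral_2_eq_2)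
  qed
  have "f analytic_on star_dom"
    unfolding analytic_on_open[OF open_star_dom] holomorphic_on_open[OF open_star_dom] using f(3) by blast
  moreover have "norm (f z) \<le> 3 \<or> norm ((deriv ^^ 2) f z) \<le> 3" if z: "z \<in> star_dom" for z
  proof -
    obtain m where m: "z \<in> ball 0 (1/4) \<union> sector m" using z by (auto simp: star_dom_def)
    note z3 = norm_le_3[OF m]
    have "norm (f z - kink_seq m z) \<le> 2"
      by (rule series_minus_term[OF f(1)[OF z]]) (use dom0 z3 regular_base[OF m] in auto)
    moreover have "norm (g' z - kink_seq'' m z) \<le> 2"
      by (rule series_minus_term[OF g(2)[OF z]]) (use dom2 z3 regular_base[OF m] in auto)
    \<comment> \<open>Near the branch point the term is small; away from it the second derivative
      is.\<close>
    moreover have "norm (kink_seq m z) \<le> 1 \<or> norm (kink_seq'' m z) \<le> 1"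
      using norm_kink_seq_near_le[OF z3, of m] norm_kink_seq''_le[OF z3, of m] slope_bounds(2)[of m] by linarith
    ultimately show ?thesis
      unfolding d2[OF z] using norm_triangle_sub[of "f z" "kink_seq m z"] norm_triangle_sub[of "g' z" "kink_seq'' m z"]
      by linarith
  qed
  moreover have "\<not> bounded (f ` star_dom)"
  proof
    assume "bounded (f ` star_dom)"
    then obtain C where C: "\<And>z. z \<in> star_dom \<Longrightarrow> norm (f z) \<le> C" unfolding bounded_iff by blast
    obtain m where m: "8 * (C + 2) < 2 ^ m" using real_arch_pow[of 2 "8 * (C + 2)"] by auto
    \<comment> \<open>A point on the axis of the sector, beyond the kink but still within abscissa
      \<open>5/4\<close>; the value \<open>9/8\<close> makes the real part of
      \<open>1 - upper m * z\<close> at most \<open>- (1/8)\<close>.\<close>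
    define z where "z = Complex (9/8) (9/8 * slope m)"
    have zs: "z \<in> sector m" using width_bounds(1)[of m] by (simp add: sector_def z_def)
    then have zm: "z \<in> ball 0 (1/4) \<union> sector m" and z: "z \<in> star_dom" by (auto simp: star_dom_def)
    define A B where "A = csqrt (1 - upper m * z)" and "B = csqrt (1 - lower m * z)"
    have A2: "A\<^sup>2 = 1 - upper m * z" and B2: "B\<^sup>2 = 1 - lower m * z" by (auto simp: A_def B_def)
    have re: "Re A \<ge> 0" "Re B \<ge> 0" unfolding A_def B_def by (rule Re_csqrt)+
    have "Im (A\<^sup>2) > 0" "Im (B\<^sup>2) < 0" unfolding A2 B2 using sector_Im[OF zs] by auto
    \<comment> \<open>The roots lie on opposite sides of the real axis, so their imaginary parts add
      up in \<open>A - B\<close>.\<close>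
    then have im: "Im A > 0" "Im B < 0"
      using re by (auto simp: power2_eq_square zero_less_mult_iff mult_less_0_iff)
    have "Re (A\<^sup>2) \<le> - (1/8)"
      unfolding A2 Re_upper using slope_bounds[of m] width_bounds[of m] by (simp add: z_def)
    moreover have "Re (A\<^sup>2) = (Re A)\<^sup>2 - (Im A)\<^sup>2" by (simp only: Re_power2)
    ultimately have "1/8 \<le> (Im A)\<^sup>2" using zero_le_power2[of "Re A"] by linarith
    also have "\<dots> \<le> (Im (A - B))\<^sup>2" using im by (intro power_mono) auto
    also have "\<dots> \<le> (norm (A - B))\<^sup>2" unfolding cmod_power2 by simp
    finally have "2 ^ m * (1/8) \<le> 2 ^ m * (norm (A - B))\<^sup>2" by (intro mult_left_mono) auto
    also have "\<dots> = norm (kink_seq m z)"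
      using slope_bounds(1)[of m]
      by (simp add: kink_def A_def B_def norm_mult norm_power norm_divide) (simp add: slope_def power_one_over)
    finally have "2 ^ m / 8 \<le> norm (kink_seq m z)" by simp
    moreover have "norm (f z - kink_seq m z) \<le> 2"
      by (rule series_minus_term[OF f(1)[OF z]])
         (use dom0 norm_le_3[OF zm] regular_base[OF zm] in auto)
    ultimately show False
      using C[OF z] m norm_triangle_ineq2[of "kink_seq m z" "f z"] by (simp add: norm_minus_commute)
  qed
  ultimately show ?thesis using that by blast
qed

section \<open>Star shape of the domain and conclusion\<close>

lemma star_dom_starlike:
  assumes "z \<in> star_dom"
  shows "closed_segment 0 z \<subseteq> star_dom"
proof
  fix w assume "w \<in> closed_segment 0 z"
  then obtain t where t: "0 \<le> t" "t \<le> 1" "w = t *\<^sub>R z" by (auto simp: closed_segment_def)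
  obtain m where m: "z \<in> ball 0 (1/4) \<union> sector m" using assms by (auto simp: star_dom_def)
  then have "w \<in> ball 0 (1/4) \<union> sector m"
  proof
    assume "z \<in> ball 0 (1/4)"
    then have "norm w \<le> norm z" using t by (simp add: mult_left_le_one_le)
    then show ?thesis using \<open>z \<in> ball 0 (1/4)\<close> by auto
  next
    assume z: "z \<in> sector m"
    show ?thesis
    \<comment> \<open>The vertex 0 is not in the open sector; it is covered by the disc.\<close>
    proof (cases "t = 0")
      case True
      then show ?thesis using t by simp
    next
      case False
      have "t * Re z \<le> Re z" using z t by (simp add: sector_def mult_left_le_one_le)
      moreover have "Im w - slope m * Re w = t * (Im z - slope m * Re z)"
        by (simp add: t(3) algebra_simps)
      then have "\<bar>Im w - slope m * Re w\<bar> = t * \<bar>Im z - slope m * Re z\<bar>"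
        using t(1) by (simp add: abs_mult)
      moreover have "t * \<bar>Im z - slope m * Re z\<bar> < t * (width m * Re z)"
        using z t False by (simp add: sector_def)
      moreover have "0 < t * Re z" using z t(1) False by (simp add: sector_def)
      ultimately have "w \<in> sector m"
        unfolding sector_def mem_Collect_eq using z by (auto simp: sector_def t(3) mult.left_commute)
      then show ?thesis ..
    qed
  qed
  then show "w \<in> star_dom" by (auto simp: star_dom_def)
qed

lemma star_dom_Rubel_1: "star_dom \<in> Rubel 1"
proof (rule starlike_bounded_in_Rubel_1[OF open_star_dom])
  show "bounded star_dom" using norm_le_3_star_dom by (auto simp: bounded_iff)
  show "0 \<in> star_dom" by (simp add: star_dom_def)
qed (rule star_dom_starlike)

lemma star_dom_simply_connected: "simply_connected star_dom"
proof (rule starlike_imp_simply_connected)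
  have "0 \<in> star_dom" by (simp add: star_dom_def)
  then show "starlike star_dom" using star_dom_starlike by (auto simp: starlike_def)
qed

text \<open>The failure already occurs at order 2, since \<open>f\<close> and its second derivative
  are never both large.\<close>

lemma star_dom_not_Rubel:
  assumes "k \<ge> 2"
  shows "star_dom \<notin> Rubel k"
proof -
  obtain f where f: "f analytic_on star_dom" "\<not> bounded (f ` star_dom)"
    "\<And>z. z \<in> star_dom \<Longrightarrow> norm (f z) \<le> 3 \<or> norm ((deriv ^^ 2) f z) \<le> 3"
    by (rule exists_unbounded) blast
  show ?thesis using f(1,2) assms f(3) by (rule not_Rubel_if_bounded_cases)
qed

theorem theorem1p3:
  shows "\<not> Rubel0 1 \<subseteq> Rubel0 3
    \<and> (\<exists>\<Omega>. complex_domain \<Omega> \<and> simply_connected \<Omega> \<and> \<Omega> \<in> Rubel 1 \<and> \<Omega> \<notin> Rubel 3)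
    \<and> \<not> Rubel 1 \<subseteq> Rubel 3"
proof -
  have "star_dom \<notin> Rubel 3" by (rule star_dom_not_Rubel) simp
  moreover have "complex_domain star_dom" using star_dom_Rubel_1 by (auto simp: Rubel_def)
  ultimately show ?thesis
    using star_dom_Rubel_1 star_dom_simply_connected by (auto simp: Rubel0_def)
qed

end
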